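(* Let $\mathcal{E}^j=\mathrm{co}(\mathcal{E}^j_0)$ be the convex hull of the finite set $\mathcal{E}^j_0=\{\xi_1,\dots,\xi_{n_j}\}$ of parameter vectors, and consider the affine polytopic LPV system $$\dot x = A(\xi)x + B_w(\xi)w + B(\xi)u,\qquad z = C(\xi)x + D(\xi)w+E(\xi)u,$$ whose real matrices $A,B_w,B,C,D,E$ depend affinely on $\xi\in\mathcal{E}^j$, with $D(\xi)=0$. Let $\gamma>0$. If there are real matrices $X=X^T\succ0$, $Y\succ 0$, and $W$ such that $$\begin{bmatrix} A(\xi)X+XA^T(\xi)+B(\xi)W+W^TB^T(\xi) & B_w(\xi)\\ B_w^T(\xi) & -I\end{bmatrix}\prec 0,$$ $$\begin{bmatrix} Y & C(\xi)X+E(\xi)W\\ XC^T(\xi)+W^TE^T(\xi) & X\end{bmatrix}\succ 0,$$ $$\mathrm{tr}(Y)<\gamma^2$$ for all $\xi\in\mathcal{E}^j_0$, then, with the static state feedback $u=Kx$, $K=WX^{-1}$, the closed-loop system is quadratically stable (on $\mathcal{E}^j$) and $\gamma$ is an upper bound for the continuous-time $\mathcal{H}_2$-norm of the closed-loop operator $T_{zw}(\xi)$ from $w$ to $z$ for all $\xi\in\mathcal{E}^j$, i.e., $$\|T_{zw}(\xi)\|_{\mathcal{H}_2}<\gamma\quad\text{for all }\xi\in\mathcal{E}^j.$$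
   Context: Here $x$ is the state, $u$ the control input, $w$ the exogenous input and $z$ the controlled output; matrices $X,Y,W$ do not depend on $\xi$. $M\succ0$ ($M\prec 0$) means $M$ is symmetric positive (negative) definite; $\mathrm{tr}$ is the trace. With $u=Kx$ the closed-loop system $T_{zw}(\xi)$ is $\dot x=A_c(\xi)x+B_c(\xi)w$, $z=C_c(\xi)x+D_c(\xi)w$ with $A_c(\xi)=A(\xi)+B(\xi)K$, $B_c(\xi)=B_w(\xi)$, $C_c(\xi)=C(\xi)+E(\xi)K$, $D_c(\xi)=D(\xi)=0$. Quadratic stability: the closed-loop system is quadratically stable if there exists a single matrix $P\succ0$ such that $A_c^T(\xi)P+PA_c(\xi)\prec0$ for all $\xi\in\mathcal{E}^j$. $\mathcal{H}_2$-norm: for each fixed $\xi$, let $T_{zw}(s)=C_c(\xi)[sI-A_c(\xi)]^{-1}B_c(\xi)$ be the transfer function matrix of the closed-loop system with the parameter frozen at $\xi$; then $\|T_{zw}(\xi)\|_{\mathcal{H}_2}^2=\frac{1}{2\pi}\mathrm{tr}\left(\int_{-\infty}^{+\infty}T_{zw}(i\omega)^H\,T_{zw}(i\omega)\,d\omega\right)$, where $(\cdot)^H$ is the conjugate transpose. *)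

theory Defs
  imports "HOL-Analysis.Analysis"
begin

definition pos_def :: "real^'n^'n \<Rightarrow> bool" where
  "pos_def M \<longleftrightarrow> transpose M = M \<and> (\<forall>v. v \<noteq> 0 \<longrightarrow> v \<bullet> (M *v v) > 0)"

definition neg_def :: "real^'n^'n \<Rightarrow> bool" where
  "neg_def M \<longleftrightarrow> transpose M = M \<and> (\<forall>v. v \<noteq> 0 \<longrightarrow> v \<bullet> (M *v v) < 0)"

(* The blocks P, Q form the first block row and R, S the second one. *)
definition block_matrix ::
  "'a^'m^'m \<Rightarrow> 'a^'k^'m \<Rightarrow> 'a^'m^'k \<Rightarrow> 'a^'k^'k \<Rightarrow> 'a^('m + 'k)^('m + 'k)" where
  "block_matrix P Q R S =
    (\<chi> i j. case i of
        Inl a \<Rightarrow> (case j of Inl b \<Rightarrow> P $ a $ b | Inr b \<Rightarrow> Q $ a $ b)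
      | Inr a \<Rightarrow> (case j of Inl b \<Rightarrow> R $ a $ b | Inr b \<Rightarrow> S $ a $ b))"

definition affine_fun_on :: "'a::real_vector set \<Rightarrow> ('a \<Rightarrow> 'b::real_vector) \<Rightarrow> bool" where
  "affine_fun_on S f \<longleftrightarrow> (\<exists>c L. linear L \<and> (\<forall>x\<in>S. f x = c + L x))"

(* The Lyapunov matrix P is common to all parameters in S. *)
definition quadratically_stable :: "('p \<Rightarrow> real^'n^'n) \<Rightarrow> 'p set \<Rightarrow> bool" where
  "quadratically_stable A S \<longleftrightarrow>
    (\<exists>P. pos_def P \<and> (\<forall>\<xi>\<in>S. neg_def (transpose (A \<xi>) ** P + P ** A \<xi>)))"

(* C (s I - A)^(-1) B + D.  For singular s I - A, matrix_inv is unspecified. *)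
definition transfer_function ::
  "real^'n^'n \<Rightarrow> real^'w^'n \<Rightarrow> real^'n^'z \<Rightarrow> real^'w^'z \<Rightarrow> complex \<Rightarrow> complex^'w^'z" where
  "transfer_function A B C D s =
     map_matrix complex_of_real C ** matrix_inv (mat s - map_matrix complex_of_real A)
       ** map_matrix complex_of_real B + map_matrix complex_of_real D"

definition conj_transpose :: "complex^'n^'m \<Rightarrow> complex^'m^'n" where
  "conj_transpose M = map_matrix cnj (transpose M)"

(* The library integral of a non-integrable function is 0; the norm is infinite in that case.
   The trace is a nonnegative real number, hence Re only changes its type. *)
definition h2_norm ::
  "real^'n^'n \<Rightarrow> real^'w^'n \<Rightarrow> real^'n^'z \<Rightarrow> real^'w^'z \<Rightarrow> ereal" where
  "h2_norm A B C D =
    (let T = transfer_function A B C D;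
         F = (\<lambda>\<omega>::real. conj_transpose (T (\<i> * complex_of_real \<omega>)) ** T (\<i> * complex_of_real \<omega>))
     in if integrable lborel F
        then ereal (sqrt (1 / (2 * pi) * Re (trace (integral\<^sup>L lborel F))))
        else \<infinity>)"

end

theory Submission
  imports Defs "HOL-Complex_Analysis.Cauchy_Integral_Theorem"
begin

text \<open>
  Both matrix inequalities are affine in the parameter, so they hold on the whole polytope. Since
  \<open>K X = W\<close>, testing the first one with \<open>(p, B\<^sub>w\<^sup>T p)\<close> gives the Lyapunov inequality
  \<open>A\<^sub>c X + X A\<^sub>c\<^sup>T + B\<^sub>w B\<^sub>w\<^sup>T < 0\<close>, hence stability with Lyapunov matrix \<open>X\<^sup>-\<^sup>1\<close>. Testing the
  second one with \<open>(e\<^sub>k, -c\<^sub>k)\<close>, where \<open>c\<^sub>k\<close> is the \<open>k\<close>-th row of \<open>C\<^sub>c\<close>, gives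
  \<open>c\<^sub>k \<bullet> X c\<^sub>k < Y\<^sub>k\<^sub>k\<close>.

  The norm is bounded without passing to the time domain. Let \<open>y\<close> solve \<open>(s - A\<^sub>c\<^sup>T) y = c\<^sub>k\<close>, so
  that the \<open>k\<close>-th row of the transfer function is \<open>B\<^sub>w\<^sup>T y\<close>. At \<open>s = i \<omega>\<close> the Lyapunov inequality
  gives \<open>|B\<^sub>w\<^sup>T y|\<^sup>2 \<le> 2 Re (X c\<^sub>k \<bullet> y)\<close>. The function \<open>X c\<^sub>k \<bullet> y\<close> is holomorphic in \<open>s\<close> on the closed right
  half-plane and equals \<open>c\<^sub>k \<bullet> X c\<^sub>k / s + O(s\<^sup>-\<^sup>2)\<close>, so closing the contour by a half circle shows
  that the integral over the imaginary axis is at most \<open>2 \<pi> c\<^sub>k \<bullet> X c\<^sub>k\<close>. Summing over \<open>k\<close> gives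
  the bound \<open>tr Y < \<gamma>\<^sup>2\<close>.
\<close>

section \<open>Integration along the imaginary axis\<close>

text \<open>\<open>g\<close> has a primitive on the closed right half-plane, so the segment from \<open>-iR\<close> to \<open>iR\<close>
  can be replaced by a half circle, on which \<open>g s\<close> is close to \<open>c / s\<close>.\<close>
lemma imaginary_axis_integral_estimate:
  fixes g :: "complex \<Rightarrow> complex"
  assumes diff: "\<And>s. Re s \<ge> 0 \<Longrightarrow> g field_differentiable at s"
    and decay: "\<And>s. Re s \<ge> 0 \<Longrightarrow> R0 \<le> cmod s \<Longrightarrow> cmod (g s - c / s) \<le> b / (cmod s)\<^sup>2"
    and R: "R0 \<le> R" "0 < R"
  shows "cmod (integral {-R..R} (\<lambda>\<omega>. g (\<i> * complex_of_real \<omega>)) - of_real pi * c) \<le> pi * b / R"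
proof -
  let ?S = "{s. Re s \<ge> 0}"
  have "continuous_on ?S g"
    by (intro continuous_at_imp_continuous_on ballI field_differentiable_imp_continuous_at diff) simp
  moreover have "g field_differentiable at s" if "s \<in> interior ?S - {}" for s
    using that interior_subset[of ?S] by (intro diff) auto
  ultimately obtain G where G: "\<And>s. s \<in> ?S \<Longrightarrow> (G has_field_derivative g s) (at s within ?S)"
    using holomorphic_convex_primitive[OF convex_halfspace_Re_ge, of "{}" 0 g] by auto
  have "((\<lambda>\<omega>. \<i> * g (\<i> * complex_of_real \<omega>)) has_integral
      G (\<i> * complex_of_real R) - G (\<i> * complex_of_real (-R))) {-R..R}"
  proof (rule fundamental_theorem_of_calculus)
    fix \<omega> :: real
    have "((G \<circ> (\<lambda>\<omega>. \<i> * complex_of_real \<omega>)) has_vector_derivative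
        \<i> * g (\<i> * complex_of_real \<omega>)) (at \<omega> within {-R..R})"
      by (rule field_vector_diff_chain_within)
        (auto intro!: derivative_eq_intros DERIV_subset[OF G])
    then show "((\<lambda>\<omega>. G (\<i> * complex_of_real \<omega>)) has_vector_derivative
        \<i> * g (\<i> * complex_of_real \<omega>)) (at \<omega> within {-R..R})"
      by (simp add: o_def)
  qed (use R in auto)
  moreover have "((\<lambda>\<theta>. \<i> * of_real R * cis \<theta> * g (of_real R * cis \<theta>)) has_integral
      G (of_real R * cis (pi/2)) - G (of_real R * cis (-(pi/2)))) {-(pi/2)..pi/2}"
  proof (rule fundamental_theorem_of_calculus)
    fix \<theta> assume \<theta>: "\<theta> \<in> {-(pi/2)..pi/2}"
    have "((G \<circ> (\<lambda>\<theta>. of_real R * cis \<theta>)) has_vector_derivative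
        (\<i> * of_real R * cis \<theta>) * g (of_real R * cis \<theta>)) (at \<theta> within {-(pi/2)..pi/2})"
    proof (rule field_vector_diff_chain_within)
      have "((\<lambda>\<theta>. of_real R * exp (\<i> * of_real \<theta>)) has_vector_derivative
          (\<i> * of_real R * exp (\<i> * of_real \<theta>))) (at \<theta> within {-(pi/2)..pi/2})"
        by (rule has_vector_derivative_real_field) (auto intro!: derivative_eq_intros)
      then show "((\<lambda>\<theta>. of_real R * cis \<theta>) has_vector_derivative
          (\<i> * of_real R * cis \<theta>)) (at \<theta> within {-(pi/2)..pi/2})"
        by (simp add: cis_conv_exp)
      show "(G has_field_derivative g (of_real R * cis \<theta>))
          (at (of_real R * cis \<theta>) within (\<lambda>\<theta>. of_real R * cis \<theta>) ` {-(pi/2)..pi/2})"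
        by (rule DERIV_subset[OF G]) (use \<theta> R in \<open>auto intro!: cos_ge_zero mult_nonneg_nonneg\<close>)
    qed
    then show "((\<lambda>\<theta>. G (of_real R * cis \<theta>)) has_vector_derivative
        \<i> * of_real R * cis \<theta> * g (of_real R * cis \<theta>)) (at \<theta> within {-(pi/2)..pi/2})"
      by (simp add: o_def)
  qed auto
  \<comment> \<open>For \<open>g s = c / s\<close> the integrand on the arc would be the constant
    \<open>i c\<close>. Its integral over an angle of length \<open>pi\<close> is the main term
    split off here.\<close>
  then have "((\<lambda>\<theta>. \<i> * of_real R * cis \<theta> * g (of_real R * cis \<theta>) - \<i> * c) has_integral
      (G (\<i> * of_real R) - G (- (\<i> * of_real R))) - pi *\<^sub>R (\<i> * c)) {-(pi/2)..pi/2}"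
    using has_integral_const_real[of "\<i> * c" "-(pi/2)" "pi/2"]
    by (intro has_integral_diff) (simp_all add: mult.commute)
  moreover have arc_bound: "cmod (\<i> * of_real R * cis \<theta> * g (of_real R * cis \<theta>) - \<i> * c) \<le> b / R"
    if \<theta>: "\<theta> \<in> {-(pi/2)..pi/2}" for \<theta>
  proof -
    let ?s = "of_real R * cis \<theta>"
    have s: "cmod ?s = R" "?s \<noteq> 0" using R by (auto simp: norm_mult)
    have "Re ?s \<ge> 0" using \<theta> R by (auto intro!: cos_ge_zero mult_nonneg_nonneg)
    then have "cmod (g ?s - c / ?s) \<le> b / R\<^sup>2"
      using decay[of ?s] s R by simp
    moreover have "\<i> * of_real R * cis \<theta> * g ?s - \<i> * c = \<i> * ?s * (g ?s - c / ?s)"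
      using s(2) by (simp add: algebra_simps)
    moreover have "cmod (\<i> * ?s * (g ?s - c / ?s)) = R * cmod (g ?s - c / ?s)"
      using s R by (simp add: norm_mult)
    ultimately have "cmod (\<i> * of_real R * cis \<theta> * g ?s - \<i> * c) \<le> R * (b / R\<^sup>2)"
      using R by (metis less_imp_le mult_left_mono)
    then show ?thesis using R by (simp add: power2_eq_square)
  qed
  \<comment> \<open>The sign of \<open>b\<close> is not assumed; the arc bound at angle 0 supplies
    the nonnegativity that \<open>has_integral_bound\<close> requires.\<close>
  moreover have "0 \<le> b / R"
    by (rule order_trans[OF norm_ge_zero arc_bound[of 0]]) simp
  ultimately have "cmod (G (\<i> * of_real R) - G (- (\<i> * of_real R)) - pi *\<^sub>R (\<i> * c)) \<le> b / R * pi"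
    using has_integral_bound[of "b / R" _ _ "-(pi/2)" "pi/2"]
    by (auto simp: box_real measure_def content_real)
  moreover have "((\<lambda>\<omega>. g (\<i> * complex_of_real \<omega>)) has_integral
      (- \<i>) * (G (\<i> * of_real R) - G (- (\<i> * of_real R)))) {-R..R}"
    using has_integral_mult_right[OF \<open>((\<lambda>\<omega>. \<i> * g (\<i> * complex_of_real \<omega>)) has_integral _) _\<close>, of "-\<i>"]
    by (simp add: mult.assoc[symmetric])
  then have "integral {-R..R} (\<lambda>\<omega>. g (\<i> * complex_of_real \<omega>)) - of_real pi * c =
      (- \<i>) * (G (\<i> * of_real R) - G (- (\<i> * of_real R)) - pi *\<^sub>R (\<i> * c))"
    by (simp add: integral_unique scaleR_conv_of_real algebra_simps)
  ultimately show ?thesis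
    by (simp add: norm_mult mult.commute)
qed

section \<open>Resolvents of Lyapunov-stable matrices\<close>

abbreviation cmat :: "real^'n^'m \<Rightarrow> complex^'n^'m" where
  "cmat M \<equiv> map_matrix complex_of_real M"

abbreviation cvec :: "real^'n \<Rightarrow> complex^'n" where
  "cvec v \<equiv> (\<chi> i. complex_of_real (v $ i))"

abbreviation Re_vec :: "complex^'n \<Rightarrow> real^'n" where
  "Re_vec v \<equiv> (\<chi> i. Re (v $ i))"

abbreviation Im_vec :: "complex^'n \<Rightarrow> real^'n" where
  "Im_vec v \<equiv> (\<chi> i. Im (v $ i))"

text \<open>Cramer's rule for the solution of \<open>(s - N) y = c\<close>, which makes it visibly rational in \<open>s\<close>.\<close>
definition resolvent :: "real^'n^'n \<Rightarrow> real^'n \<Rightarrow> complex \<Rightarrow> complex^'n" where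
  "resolvent N c s = (\<chi> k. det (\<chi> i j. if j = k then cvec c $ i else (mat s - cmat N) $ i $ j)
     / det (mat s - cmat N))"

lemma shifted_mult_vec:
  "(mat s - cmat N) *v y = s *s y - cmat N *v y"
  by (simp add: vec_eq_iff matrix_vector_mult_def mat_def algebra_simps sum_subtractf
      if_distrib[of "\<lambda>x. _ * x"] if_distrib[of "\<lambda>x. x * _"] cong: if_cong)

lemma resolvent_iff:
  assumes "det (mat s - cmat N) \<noteq> 0"
  shows "(mat s - cmat N) *v y = cvec c \<longleftrightarrow> y = resolvent N c s"
  using cramer[OF assms] by (simp add: resolvent_def)

text \<open>Splits the complex equation into two real ones, so that a Lyapunov inequality for real
  vectors can be applied to the real and imaginary parts of \<open>y\<close> separately.\<close>

lemma resolvent_real_parts: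
  assumes "(mat s - cmat N) *v y = cvec c"
  shows "N *v Re_vec y = Re s *\<^sub>R Re_vec y - Im s *\<^sub>R Im_vec y - c"
    and "N *v Im_vec y = Re s *\<^sub>R Im_vec y + Im s *\<^sub>R Re_vec y"
proof -
  have "s * y $ i - (\<Sum>j\<in>UNIV. complex_of_real (N $ i $ j) * y $ j) = complex_of_real (c $ i)" for i
    using assms unfolding shifted_mult_vec
    by (simp add: vec_eq_iff matrix_vector_mult_def)
  then have "Re (s * y $ i - (\<Sum>j\<in>UNIV. complex_of_real (N $ i $ j) * y $ j)) = c $ i"
    "Im (s * y $ i - (\<Sum>j\<in>UNIV. complex_of_real (N $ i $ j) * y $ j)) = 0" for i
    by simp_all
  then show "N *v Re_vec y = Re s *\<^sub>R Re_vec y - Im s *\<^sub>R Im_vec y - c"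
    and "N *v Im_vec y = Re s *\<^sub>R Im_vec y + Im s *\<^sub>R Re_vec y"
    by (simp_all add: vec_eq_iff matrix_vector_mult_def algebra_simps)
qed

section \<open>Lyapunov inequalities exclude eigenvalues in the closed right half-plane\<close>

lemma pos_def_symmetric:
  assumes "pos_def X"
  shows "(X *v p) \<bullet> q = p \<bullet> (X *v q)"
  using assms dot_lmul_matrix[of p X q] transpose_matrix_vector[of X p] by (simp add: pos_def_def)

lemma pos_def_nonneg: "pos_def X \<Longrightarrow> v \<bullet> (X *v v) \<ge> 0"
  by (cases "v = 0") (auto simp: pos_def_def less_imp_le)

text \<open>A kernel vector \<open>p + i q\<close> would make \<open>X p . N p + X q . N q\<close>
  equal to \<open>Re s\<close> times a nonnegative number, while the hypothesis makes it negative
  unless \<open>p = q = 0\<close>.\<close>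

lemma lyapunov_det_nonzero:
  assumes X: "pos_def X" and N: "\<And>p. p \<noteq> 0 \<Longrightarrow> (X *v p) \<bullet> (N *v p) < 0" and s: "Re s \<ge> 0"
  shows "det (mat s - cmat N) \<noteq> 0"
proof -
  have "y = 0" if y: "(mat s - cmat N) *v y = 0" for y
  proof (rule ccontr)
    assume "y \<noteq> 0"
    let ?p = "Re_vec y" and ?q = "Im_vec y"
    have "(mat s - cmat N) *v y = cvec 0" using y by (simp add: vec_eq_iff)
    note parts = resolvent_real_parts[OF this]
    \<comment> \<open>The two cross terms carrying \<open>Im s\<close> have opposite signs and
      cancel by the symmetry of \<open>X\<close>.\<close>
    have "(X *v ?p) \<bullet> (N *v ?p) + (X *v ?q) \<bullet> (N *v ?q) = 
        Re s * (?p \<bullet> (X *v ?p)) + Re s * (?q \<bullet> (X *v ?q))"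
      unfolding parts using pos_def_symmetric[OF X, of ?p ?q]
      by (simp add: inner_add_right inner_diff_right pos_def_symmetric[OF X] inner_commute)
    also have "\<dots> \<ge> 0"
      using s by (intro add_nonneg_nonneg mult_nonneg_nonneg pos_def_nonneg[OF X])
    finally have *: "(X *v ?p) \<bullet> (N *v ?p) + (X *v ?q) \<bullet> (N *v ?q) \<ge> 0" .
    have "?p \<noteq> 0 \<or> ?q \<noteq> 0"
      using \<open>y \<noteq> 0\<close> by (auto simp: vec_eq_iff complex_eq_iff)
    moreover have "(X *v p) \<bullet> (N *v p) \<le> 0" for p
      using N[of p] by (cases "p = 0") auto
    ultimately show False
      using * N[of ?p] N[of ?q] by (metis add_neg_nonpos add_nonpos_neg not_le)
  qed
  then have "invertible (mat s - cmat N)"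
    unfolding invertible_left_inverse matrix_left_invertible_ker by blast
  then show ?thesis by (simp add: invertible_det_nz)
qed

section \<open>Holomorphy of the resolvent and its behaviour at infinity\<close>

lemma det_field_differentiable:
  fixes F :: "complex \<Rightarrow> complex^'n^'n"
  assumes "\<And>i j. (\<lambda>s. F s $ i $ j) holomorphic_on UNIV"
  shows "(\<lambda>s. det (F s)) field_differentiable at s"
proof -
  have "(\<lambda>s. det (F s)) holomorphic_on UNIV"
    unfolding det_def by (intro holomorphic_intros assms)
  then show ?thesis by (simp add: holomorphic_on_def)
qed

lemma resolvent_field_differentiable:
  assumes "det (mat s - cmat N) \<noteq> 0"
  shows "(\<lambda>s. resolvent N c s $ k) field_differentiable at s"
proof -
  have *: "(\<lambda>s. (mat s - cmat N) $ i $ j) holomorphic_on UNIV" for i j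
    by (cases "i = j") (auto simp: mat_def intro!: holomorphic_intros)
  have "(\<lambda>s. (\<chi> i j. if j = k then cvec c $ i else (mat s - cmat N) $ i $ j) $ i $ j)
      holomorphic_on UNIV" for i j
    unfolding vec_lambda_beta using *[of i j] by (cases "j = k") auto
  note numerator = det_field_differentiable[OF this]
  show ?thesis
    unfolding resolvent_def vec_lambda_beta
    by (rule field_differentiable_divide[OF numerator[unfolded vec_lambda_beta]
          det_field_differentiable[OF *] assms])
qed

lemma norm_vector_scalar_mult:
  fixes v :: "complex^'n"
  shows "norm (s *s v) = cmod s * norm v"
  by (simp add: norm_vec_def norm_mult L2_set_right_distrib)

text \<open>The error is \<open>s y - c = N y\<close>. For \<open>cmod s\<close> at least
  \<open>2 L\<close>, the term \<open>N y\<close> absorbs at most half of \<open>s y\<close>, so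
  \<open>y\<close> itself is bounded by \<open>2 norm c / cmod s\<close>.\<close>

lemma resolvent_expansion:
  assumes L: "\<And>y. norm (cmat N *v y) \<le> L * norm y" "0 \<le> L"
    and s: "2 * L \<le> cmod s" "s \<noteq> 0"
    and y: "(mat s - cmat N) *v y = cvec c"
  shows "norm (s *s y - cvec c) \<le> L * (2 * norm (cvec c) / cmod s)"
proof -
  have eq: "s *s y - cvec c = cmat N *v y"
    using y unfolding shifted_mult_vec by (simp add: algebra_simps)
  have "s *s y = cmat N *v y + cvec c" using eq by (simp add: algebra_simps)
  then have "cmod s * norm y \<le> L * norm y + norm (cvec c)"
    using norm_triangle_ineq[of "cmat N *v y" "cvec c"] L(1)[of y]
    by (simp flip: norm_vector_scalar_mult)
  moreover have "2 * L * norm y \<le> cmod s * norm y"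
    using s by (intro mult_right_mono) auto
  ultimately have "norm y \<le> 2 * norm (cvec c) / cmod s"
    using s by (simp add: field_simps)
  then have "L * norm y \<le> L * (2 * norm (cvec c) / cmod s)"
    using L(2) by (rule mult_left_mono)
  then show ?thesis unfolding eq using L(1)[of y] by simp
qed

text \<open>Pairing the expansion with \<open>h\<close> and dividing by \<open>s\<close> leaves the
  leading term \<open>(h . c) / s\<close> and a quadratic error, which is the decay hypothesis of
  \<open>imaginary_axis_integral_estimate\<close>.\<close>

lemma resolvent_output_decay:
  fixes N :: "real^'n^'n"
  assumes det: "\<And>s. Re s \<ge> 0 \<Longrightarrow> det (mat s - cmat N) \<noteq> 0"
  shows "\<exists>R0 b. \<forall>s. Re s \<ge> 0 \<longrightarrow> R0 \<le> cmod s \<longrightarrow>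
    cmod ((\<Sum>i\<in>UNIV. of_real (h $ i) * resolvent N c s $ i) - of_real (h \<bullet> c) / s) \<le> b / (cmod s)\<^sup>2"
proof -
  obtain L where L: "0 < L" "\<And>y. norm (cmat N *v y) \<le> L * norm y"
    using bounded_linear.pos_bounded[OF matrix_vector_mul_bounded_linear[of "cmat N"]]
    by (auto simp: mult.commute)
  define b where "b = (\<Sum>i\<in>UNIV. \<bar>h $ i\<bar>) * (L * (2 * norm (cvec c)))"
  show ?thesis
  proof (intro exI allI impI)
    fix s assume s: "Re s \<ge> 0" "2 * L \<le> cmod s"
    then have s0: "s \<noteq> 0" using L(1) by auto
    let ?y = "resolvent N c s"
    have "(mat s - cmat N) *v ?y = cvec c" using resolvent_iff[OF det[OF s(1)]] by simp
    note ex = resolvent_expansion[OF L(2) less_imp_le[OF L(1)] s(2) s0 this]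
    have "(\<Sum>i\<in>UNIV. of_real (h $ i) * ?y $ i) - of_real (h \<bullet> c) / s
        = (\<Sum>i\<in>UNIV. of_real (h $ i) * (s *s ?y - cvec c) $ i) / s"
      using s0 by (simp add: inner_vec_def sum_subtractf field_simps sum_distrib_left)
    moreover have "cmod (\<Sum>i\<in>UNIV. of_real (h $ i) * (s *s ?y - cvec c) $ i)
        \<le> (\<Sum>i\<in>UNIV. \<bar>h $ i\<bar> * (L * (2 * norm (cvec c) / cmod s)))"
    proof (intro sum_norm_le)
      fix i
      have "cmod ((s *s ?y - cvec c) $ i) \<le> L * (2 * norm (cvec c) / cmod s)"
        using ex Finite_Cartesian_Product.norm_nth_le order_trans by blast
      then show "cmod (of_real (h $ i) * (s *s ?y - cvec c) $ i)
          \<le> \<bar>h $ i\<bar> * (L * (2 * norm (cvec c) / cmod s))"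
        by (simp only: norm_mult norm_of_real) (intro mult_left_mono, auto)
    qed
    ultimately have "cmod ((\<Sum>i\<in>UNIV. of_real (h $ i) * ?y $ i) - of_real (h \<bullet> c) / s)
        \<le> (\<Sum>i\<in>UNIV. \<bar>h $ i\<bar> * (L * (2 * norm (cvec c) / cmod s))) / cmod s"
      using s0 by (simp add: norm_divide divide_right_mono)
    also have "\<dots> = b / (cmod s)\<^sup>2"
      by (simp add: b_def power2_eq_square flip: sum_distrib_right sum_divide_distrib)
    finally show "cmod ((\<Sum>i\<in>UNIV. of_real (h $ i) * ?y $ i) - of_real (h \<bullet> c) / s)
        \<le> b / (cmod s)\<^sup>2" .
  qed
qed

text \<open>With \<open>y = p + i q\<close> one has \<open>N p = - \<omega> q - c\<close> and \<open>N q = \<omega> p\<close>. The terms containing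
  \<open>\<omega>\<close> cancel in \<open>X p \<bullet> N p + X q \<bullet> N q\<close>, which leaves \<open>- X p \<bullet> c\<close>.\<close>
lemma resolvent_energy:
  assumes X: "pos_def X"
    and N: "\<And>p. 2 * ((X *v p) \<bullet> (N *v p)) + (G *v p) \<bullet> (G *v p) \<le> 0"
    and y: "(mat (\<i> * complex_of_real \<omega>) - cmat N) *v y = cvec c"
  shows "(\<Sum>l\<in>UNIV. (cmod (\<Sum>j\<in>UNIV. of_real (G $ l $ j) * y $ j))\<^sup>2)
    \<le> 2 * Re (\<Sum>i\<in>UNIV. of_real ((X *v c) $ i) * y $ i)"
proof -
  let ?p = "Re_vec y" and ?q = "Im_vec y"
  note parts = resolvent_real_parts[OF y]
  have "(\<Sum>l\<in>UNIV. (cmod (\<Sum>j\<in>UNIV. of_real (G $ l $ j) * y $ j))\<^sup>2)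
      = (G *v ?p) \<bullet> (G *v ?p) + (G *v ?q) \<bullet> (G *v ?q)"
    by (simp add: cmod_power2 inner_vec_def matrix_vector_mult_def sum.distrib flip: power2_eq_square)
  also have "\<dots> \<le> - 2 * ((X *v ?p) \<bullet> (N *v ?p) + (X *v ?q) \<bullet> (N *v ?q))"
    using N[of ?p] N[of ?q] by simp
  also have "\<dots> = 2 * ((X *v ?p) \<bullet> c)"
    unfolding parts using pos_def_symmetric[OF X, of ?p ?q]
    by (simp add: inner_add_right inner_diff_right inner_commute)
  also have "(X *v ?p) \<bullet> c = Re (\<Sum>i\<in>UNIV. of_real ((X *v c) $ i) * y $ i)"
    using pos_def_symmetric[OF X, of ?p c] by (simp add: inner_vec_def mult.commute)
  finally show ?thesis .
qed

section \<open>The Gramian bound for the H2 norm\<close>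

text \<open>Monotone convergence: the integrals over \<open>{-n..n}\<close> increase and are
  eventually at most \<open>a + b / n\<close>, hence all at most \<open>a\<close>. Integrability is
  a conclusion here, which is what keeps the H2 norm finite.\<close>

lemma integrable_symmetric_limit:
  fixes f :: "real \<Rightarrow> real"
  assumes cont: "continuous_on UNIV f" and nonneg: "\<And>x. 0 \<le> f x"
    and bound: "\<And>R. R0 \<le> R \<Longrightarrow> 0 < R \<Longrightarrow> integral {-R..R} f \<le> a + b / R"
  shows "integrable lborel f" and "integral\<^sup>L lborel f \<le> a"
proof -
  define I where "I n = integral {- real n..real n} f" for n
  define u where "u n x = indicator {- real n..real n} x * f x" for n x
  have set_int: "set_integrable lborel {- real n..real n} f" for n
    by (rule borel_integrable_atLeastAtMost') (rule continuous_on_subset[OF cont], simp)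
  have u_int: "integrable lborel (u n)" for n
    using set_int[of n] unfolding set_integrable_def u_def by simp
  have u_eq: "integral\<^sup>L lborel (u n) = I n" for n
    using set_borel_integral_eq_integral(2)[OF set_int[of n]]
    unfolding set_lebesgue_integral_def u_def I_def by simp
  have u_mono: "mono (\<lambda>n. u n x)" for x
    unfolding u_def by (intro monoI mult_right_mono nonneg) (auto simp: indicator_def)
  have I_mono: "incseq I"
    unfolding u_eq[symmetric]
    by (intro incseq_SucI integral_mono u_int monoD[OF u_mono]) simp
  have I_ev: "\<forall>\<^sub>F n in sequentially. I n \<le> a + b / real n"
  proof -
    obtain m where m: "R0 \<le> real m" using real_arch_simple by blast
    show ?thesis
      \<comment> \<open>Starting at \<open>Suc m\<close> ensures both \<open>R0 \<le> n\<close> and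
        \<open>0 < n\<close>.\<close>
      using eventually_ge_at_top[of "Suc m"]
      by eventually_elim (unfold I_def, rule bound, use m in linarith, use m in simp)
  qed
  moreover have lim: "(\<lambda>n. a + b / real n) \<longlonglongrightarrow> a"
    using tendsto_add[OF tendsto_const lim_const_over_n[of b], of a] by simp
  ultimately have I_le: "I n \<le> a" for n
  proof -
    have "\<forall>\<^sub>F m in sequentially. I n \<le> a + b / real m"
      using I_ev eventually_ge_at_top[of n]
      by eventually_elim (meson I_mono incseqD order_trans)
    then show ?thesis using lim tendsto_lowerbound[of _ a sequentially "I n"] by simp
  qed
  then obtain x where x: "I \<longlonglongrightarrow> x" using incseq_convergent[OF I_mono, of a] by blast
  have u_lim: "(\<lambda>n. u n x) \<longlonglongrightarrow> f x" for x
  proof (rule tendsto_eventually)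
    obtain m where m: "\<bar>x\<bar> \<le> real m" using real_arch_simple by blast
    show "\<forall>\<^sub>F n in sequentially. u n x = f x"
      using eventually_ge_at_top[of m]
      by eventually_elim (use m in \<open>auto simp: u_def indicator_def\<close>)
  qed
  have f_meas: "f \<in> borel_measurable lborel"
    using borel_measurable_continuous_onI[OF cont] by simp
  have *: "(\<lambda>n. integral\<^sup>L lborel (u n)) \<longlonglongrightarrow> x" using x by (simp add: u_eq)
  show "integrable lborel f"
    by (rule integrable_monotone_convergence[OF u_int _ _ * f_meas])
      (intro AE_I2 u_mono u_lim)+
  have "integral\<^sup>L lborel f = x"
    by (rule integral_monotone_convergence[OF u_int _ _ * f_meas])
      (intro AE_I2 u_mono u_lim)+
  then show "integral\<^sup>L lborel f \<le> a"
    using LIMSEQ_le_const2[OF x, of a] I_le by simp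
qed

lemma resolvent_continuous:
  assumes det: "\<And>s. Re s \<ge> 0 \<Longrightarrow> det (mat s - cmat N) \<noteq> 0"
  shows "continuous_on UNIV (\<lambda>\<omega>. resolvent N c (\<i> * complex_of_real \<omega>) $ j)"
proof (rule continuous_at_imp_continuous_on, rule ballI)
  fix \<omega> :: real
  have "isCont (\<lambda>s. resolvent N c s $ j) (\<i> * complex_of_real \<omega>)"
    by (intro field_differentiable_imp_continuous_at resolvent_field_differentiable det) simp
  moreover have "isCont (\<lambda>\<omega>. \<i> * complex_of_real \<omega>) \<omega>"
    by (intro continuous_intros)
  ultimately show "isCont (\<lambda>\<omega>. resolvent N c (\<i> * complex_of_real \<omega>) $ j) \<omega>"
    by (rule isCont_o2[rotated])
qed

text \<open>The pointwise bound \<open>resolvent_energy\<close> is integrated over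
  \<open>{-R..R}\<close>. The half circle contributes \<open>pi (c . X c)\<close>, the energy bound
  carries a factor 2, and the error of order \<open>1 / R\<close> vanishes in the limit.\<close>

lemma resolvent_energy_integral:
  fixes N X :: "real^'n^'n" and G :: "real^'n^'w" and c :: "real^'n"
  assumes X: "pos_def X"
    and N: "\<And>p. p \<noteq> 0 \<Longrightarrow> 2 * ((X *v p) \<bullet> (N *v p)) + (G *v p) \<bullet> (G *v p) < 0"
  defines "f \<equiv> \<lambda>\<omega>. \<Sum>l\<in>UNIV. (cmod (\<Sum>j\<in>UNIV. of_real (G $ l $ j) *
      resolvent N c (\<i> * complex_of_real \<omega>) $ j))\<^sup>2"
  shows "integrable lborel f" and "integral\<^sup>L lborel f \<le> 2 * pi * (c \<bullet> (X *v c))"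
proof -
  \<comment> \<open>Dropping the nonnegative term in \<open>G\<close> leaves a strict Lyapunov
    inequality, so the resolvent has no pole in the closed right half-plane.\<close>
  have "(X *v p) \<bullet> (N *v p) < 0" if "p \<noteq> 0" for p
    using N[OF that] inner_ge_zero[of "G *v p"] by linarith
  then have det: "det (mat s - cmat N) \<noteq> 0" if "Re s \<ge> 0" for s
    using lyapunov_det_nonzero[OF X _ that] by blast
  define g where "g s = (\<Sum>i\<in>UNIV. of_real ((X *v c) $ i) * resolvent N c s $ i)" for s
  have "\<exists>R0 b. \<forall>s. Re s \<ge> 0 \<longrightarrow> R0 \<le> cmod s \<longrightarrow>
      cmod (g s - of_real ((X *v c) \<bullet> c) / s) \<le> b / (cmod s)\<^sup>2"
    unfolding g_def using det by (rule resolvent_output_decay)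
  then obtain R0 b where decay: "\<And>s. Re s \<ge> 0 \<Longrightarrow> R0 \<le> cmod s \<Longrightarrow>
      cmod (g s - of_real ((X *v c) \<bullet> c) / s) \<le> b / (cmod s)\<^sup>2"
    by blast
  have cont_f: "continuous_on UNIV f"
    unfolding f_def by (intro continuous_intros resolvent_continuous det)
  have cont_g: "continuous_on UNIV (\<lambda>\<omega>. g (\<i> * complex_of_real \<omega>))"
    unfolding g_def by (intro continuous_intros resolvent_continuous det)
  have g_diff: "g field_differentiable at s" if "Re s \<ge> 0" for s
    unfolding g_def using that
    by (intro field_differentiable_sum field_differentiable_mult field_differentiable_const
        resolvent_field_differentiable det)
  have fg: "f \<omega> \<le> 2 * Re (g (\<i> * complex_of_real \<omega>))" for \<omega>
    unfolding f_def g_def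
  proof (rule resolvent_energy[OF X])
    show "2 * ((X *v p) \<bullet> (N *v p)) + (G *v p) \<bullet> (G *v p) \<le> 0" for p
      using N[of p] by (cases "p = 0") auto
    show "(mat (\<i> * complex_of_real \<omega>) - cmat N) *v resolvent N c (\<i> * complex_of_real \<omega>) = cvec c"
      by (rule resolvent_iff[OF det, THEN iffD2]) simp_all
  qed
  have bound: "integral {-R..R} f \<le> 2 * pi * (c \<bullet> (X *v c)) + (2 * pi * b) / R"
    if R: "R0 \<le> R" "0 < R" for R
  proof -
    let ?I = "integral {-R..R} (\<lambda>\<omega>. g (\<i> * complex_of_real \<omega>))"
    have g_int: "(\<lambda>\<omega>. g (\<i> * complex_of_real \<omega>)) integrable_on {-R..R}"
      by (intro integrable_continuous_interval continuous_on_subset[OF cont_g]) simp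
    have "continuous_on UNIV (\<lambda>\<omega>. 2 * Re (g (\<i> * complex_of_real \<omega>)))"
      by (intro continuous_on_mult continuous_on_const continuous_on_Re cont_g)
    then have "integral {-R..R} f \<le> integral {-R..R} (\<lambda>\<omega>. 2 * Re (g (\<i> * complex_of_real \<omega>)))"
      using cont_f fg
      by (intro integral_le integrable_continuous_interval) (erule continuous_on_subset, simp)+
    also have "\<dots> = 2 * Re ?I"
      using integral_linear[OF g_int bounded_linear_Re] by (simp add: o_def)
    also have "Re ?I \<le> pi * (c \<bullet> (X *v c)) + pi * b / R"
    proof -
      have "Re (?I - of_real pi * of_real ((X *v c) \<bullet> c)) \<le> pi * b / R"
        by (rule order_trans[OF complex_Re_le_cmod imaginary_axis_integral_estimate])
          (use g_diff decay R in simp_all)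
      then show ?thesis by (simp add: inner_commute)
    qed
    finally show ?thesis by (simp add: algebra_simps)
  qed
  have nonneg: "0 \<le> f \<omega>" for \<omega> unfolding f_def by (intro sum_nonneg) simp
  show "integrable lborel f"
    using cont_f nonneg bound by (rule integrable_symmetric_limit(1))
  show "integral\<^sup>L lborel f \<le> 2 * pi * (c \<bullet> (X *v c))"
    using cont_f nonneg bound by (rule integrable_symmetric_limit(2))
qed

section \<open>From the resolvent to the transfer function and its Gram matrix\<close>

lemma matrix_inv_mult:
  fixes M :: "'a::field^'n^'n"
  assumes "invertible M"
  shows "M ** matrix_inv M = mat 1" "matrix_inv M ** M = mat 1"
proof -
  have "M ** matrix_inv M = mat 1 \<and> matrix_inv M ** M = mat 1"
    using assms unfolding invertible_def matrix_inv_def by (rule someI_ex)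
  then show "M ** matrix_inv M = mat 1" "matrix_inv M ** M = mat 1" by blast+
qed

text \<open>The \<open>k\<close>-th row \<open>r\<close> of \<open>C (s - A)^(-1)\<close> satisfies
  \<open>r (s - A) = C $ k\<close>. Transposing gives the equation that characterises the resolvent
  of \<open>transpose A\<close> at \<open>C $ k\<close>.\<close>

lemma transfer_function_component:
  fixes A :: "real^'n^'n" and B :: "real^'w^'n" and C :: "real^'n^'z"
  assumes det: "det (mat s - cmat (transpose A)) \<noteq> 0"
  shows "transfer_function A B C 0 s $ k $ l =
    (\<Sum>j\<in>UNIV. of_real (transpose B $ l $ j) * resolvent (transpose A) (C $ k) s $ j)"
proof -
  let ?M = "mat s - cmat A"
  have tr: "transpose ?M = mat s - cmat (transpose A)"
    by (simp add: vec_eq_iff transpose_def mat_def)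
  then have "invertible ?M"
    using det by (metis det_transpose invertible_det_nz)
  then have "(cmat C ** matrix_inv ?M) ** ?M = cmat C"
    by (simp add: matrix_inv_mult flip: matrix_mul_assoc)
  moreover have "(transpose ?M *v (P $ k)) = (P ** ?M) $ k" for P :: "complex^'n^'z"
    by (simp add: vec_eq_iff vector_matrix_mult_def matrix_matrix_mult_def mult.commute)
  ultimately have "transpose ?M *v ((cmat C ** matrix_inv ?M) $ k) = cvec (C $ k)"
    by (simp add: vec_eq_iff)
  then have "(cmat C ** matrix_inv ?M) $ k = resolvent (transpose A) (C $ k) s"
    unfolding tr resolvent_iff[OF det] .
  moreover have "transfer_function A B C 0 s $ k $ l =
      (\<Sum>j\<in>UNIV. (cmat C ** matrix_inv ?M) $ k $ j * cmat B $ j $ l)"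
    by (simp add: transfer_function_def matrix_matrix_mult_def)
  ultimately show ?thesis by (simp add: transpose_def mult.commute)
qed

lemma gram_component:
  "(conj_transpose T ** T) $ i $ j = (\<Sum>k\<in>UNIV. cnj (T $ k $ i) * T $ k $ j)"
  by (simp add: conj_transpose_def matrix_matrix_mult_def transpose_def)

lemma trace_gram:
  "Re (trace (conj_transpose T ** T)) = (\<Sum>k\<in>UNIV. \<Sum>l\<in>UNIV. (cmod (T $ k $ l))\<^sup>2)"
  unfolding trace_def gram_component
  by (subst (2) sum.swap) (simp add: cmod_power2 flip: power2_eq_square)

text \<open>A crude domination of the matrix-valued integrand by its trace, used to deduce
  integrability of the matrix from that of scalar functions. The cardinalities come from bounding
  each Euclidean norm by a sum of entries.\<close>

lemma norm_gram_le:
  fixes T :: "complex^'w^'z"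
  shows "norm (conj_transpose T ** T) \<le>
    real CARD('w) * real CARD('w) * (\<Sum>k\<in>UNIV. \<Sum>l\<in>UNIV. (cmod (T $ k $ l))\<^sup>2)"
proof -
  let ?f = "\<Sum>k\<in>UNIV. \<Sum>l\<in>UNIV. (cmod (T $ k $ l))\<^sup>2"
  have "cmod ((conj_transpose T ** T) $ i $ j) \<le> ?f" for i j
  proof -
    have "cmod (cnj (T $ k $ i) * T $ k $ j) \<le> (\<Sum>l\<in>UNIV. (cmod (T $ k $ l))\<^sup>2)" for k
    \<comment> \<open>The product of two entries of a row is at most the square of the larger one,
      which is a summand of the row sum.\<close>
    proof (cases "cmod (T $ k $ i) \<le> cmod (T $ k $ j)")
      case True
      then have "cmod (cnj (T $ k $ i) * T $ k $ j) \<le> (cmod (T $ k $ j))\<^sup>2"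
        by (simp add: norm_mult power2_eq_square mult_right_mono)
      also have "\<dots> \<le> (\<Sum>l\<in>UNIV. (cmod (T $ k $ l))\<^sup>2)" by (rule member_le_sum) auto
      finally show ?thesis .
    next
      case False
      then have "cmod (cnj (T $ k $ i) * T $ k $ j) \<le> (cmod (T $ k $ i))\<^sup>2"
        by (simp add: norm_mult power2_eq_square mult_left_mono)
      also have "\<dots> \<le> (\<Sum>l\<in>UNIV. (cmod (T $ k $ l))\<^sup>2)" by (rule member_le_sum) auto
      finally show ?thesis .
    qed
    then show ?thesis unfolding gram_component by (rule sum_norm_le)
  qed
  then have "norm ((conj_transpose T ** T) $ i) \<le> (\<Sum>j\<in>(UNIV::'w set). ?f)" for i
    unfolding norm_vec_def[where 'b='w]
    by (intro order_trans[OF L2_set_le_sum] sum_mono) auto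
  then have "norm (conj_transpose T ** T) \<le> (\<Sum>i\<in>(UNIV::'w set). \<Sum>j\<in>(UNIV::'w set). ?f)"
    unfolding norm_vec_def[of "conj_transpose T ** T"]
    by (intro order_trans[OF L2_set_le_sum] sum_mono) auto
  then show ?thesis by (simp add: mult.assoc)
qed

text \<open>The sum is \<open>tr (C X C^T)\<close>. Each row of the transfer function contributes at
  most \<open>2 pi\<close> times its summand, and the normalisation of the norm cancels
  \<open>2 pi\<close>.\<close>

lemma h2_norm_le_gramian:
  fixes A X :: "real^'n^'n" and B :: "real^'w^'n" and C :: "real^'n^'z"
  assumes X: "pos_def X"
    and lyap: "\<And>p. p \<noteq> 0 \<Longrightarrow>
      2 * ((X *v p) \<bullet> (transpose A *v p)) + (transpose B *v p) \<bullet> (transpose B *v p) < 0"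
  shows "h2_norm A B C 0 \<le> ereal (sqrt (\<Sum>k\<in>UNIV. C $ k \<bullet> (X *v (C $ k))))"
proof -
  have "(X *v p) \<bullet> (transpose A *v p) < 0" if "p \<noteq> 0" for p
    using lyap[OF that] inner_ge_zero[of "transpose B *v p"] by linarith
  then have det: "det (mat s - cmat (transpose A)) \<noteq> 0" if "Re s \<ge> 0" for s
    using lyapunov_det_nonzero[OF X _ that] by blast
  define T where "T \<omega> = transfer_function A B C 0 (\<i> * complex_of_real \<omega>)" for \<omega>
  define F where "F \<omega> = conj_transpose (T \<omega>) ** T \<omega>" for \<omega>
  define f where "f k \<omega> = (\<Sum>l\<in>UNIV. (cmod (T \<omega> $ k $ l))\<^sup>2)" for k \<omega>
  have T: "T \<omega> $ k $ l = (\<Sum>j\<in>UNIV. of_real (transpose B $ l $ j) *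
      resolvent (transpose A) (C $ k) (\<i> * complex_of_real \<omega>) $ j)" for \<omega> k l
    unfolding T_def by (rule transfer_function_component, rule det) auto
  have f_int: "integrable lborel (f k)"
    and f_le: "integral\<^sup>L lborel (f k) \<le> 2 * pi * (C $ k \<bullet> (X *v (C $ k)))" for k
    unfolding f_def T using resolvent_energy_integral[OF X lyap] by blast+
  have T_cont: "continuous_on UNIV (\<lambda>\<omega>. T \<omega> $ k $ l)" for k l
    unfolding T by (intro continuous_intros resolvent_continuous det)
  have "F = (\<lambda>\<omega>. \<chi> i j. \<Sum>k\<in>UNIV. cnj (T \<omega> $ k $ i) * T \<omega> $ k $ j)"
    by (simp add: fun_eq_iff vec_eq_iff F_def gram_component)
  moreover have "continuous_on UNIV (\<lambda>\<omega>. \<chi> i j. \<Sum>k\<in>UNIV. cnj (T \<omega> $ k $ i) * T \<omega> $ k $ j)"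
    by (intro continuous_on_vec_lambda continuous_intros T_cont)
  ultimately have F_meas: "F \<in> borel_measurable lborel"
    using borel_measurable_continuous_onI by auto
  have F_int: "integrable lborel F"
  proof (rule Bochner_Integration.integrable_bound[OF _ F_meas])
    show "integrable lborel (\<lambda>\<omega>. real CARD('w) * real CARD('w) * (\<Sum>k\<in>UNIV. f k \<omega>))"
      by (intro integrable_mult_right Bochner_Integration.integrable_sum f_int)
    show "AE \<omega> in lborel. norm (F \<omega>) \<le>
        norm (real CARD('w) * real CARD('w) * (\<Sum>k\<in>UNIV. f k \<omega>))"
      unfolding F_def f_def by (intro AE_I2 order_trans[OF norm_gram_le]) simp
  qed
  \<comment> \<open>A bounded linear functional commutes with the Bochner integral, which reduces
    the matrix integral to the row energies.\<close>
  have "bounded_linear (\<lambda>M::complex^'w^'w. Re (trace M))"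
    unfolding trace_def
    by (intro linear_conv_bounded_linear[THEN iffD1] linearI)
      (simp_all add: sum.distrib sum_distrib_left)
  from integral_bounded_linear[OF this F_int]
  have "Re (trace (integral\<^sup>L lborel F)) = (\<integral>\<omega>. (\<Sum>k\<in>UNIV. f k \<omega>) \<partial>lborel)"
    by (simp add: F_def f_def trace_gram)
  also have "\<dots> = (\<Sum>k\<in>UNIV. integral\<^sup>L lborel (f k))"
    by (intro Bochner_Integration.integral_sum f_int)
  also have "\<dots> \<le> (\<Sum>k\<in>UNIV. 2 * pi * (C $ k \<bullet> (X *v (C $ k))))"
    by (intro sum_mono f_le)
  also have "\<dots> = 2 * pi * (\<Sum>k\<in>UNIV. C $ k \<bullet> (X *v (C $ k)))"
    by (simp add: sum_distrib_left)
  finally have "1 / (2 * pi) * Re (trace (integral\<^sup>L lborel F)) \<le> (\<Sum>k\<in>UNIV. C $ k \<bullet> (X *v (C $ k)))"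
    by (simp add: field_simps)
  \<comment> \<open>\<open>F_int\<close> selects the finite branch of the definition.\<close>
  moreover have "h2_norm A B C 0 = ereal (sqrt (1 / (2 * pi) * Re (trace (integral\<^sup>L lborel F))))"
    using F_int unfolding h2_norm_def F_def T_def by (simp add: Let_def)
  ultimately show ?thesis by (simp only: ereal_less_eq real_sqrt_le_iff)
qed

section \<open>Linear matrix inequalities on the polytope\<close>

lemma sum_type_inner_block:
  fixes v :: "real^'m" and w :: "real^'k"
  defines "x \<equiv> (\<chi> i. case i of Inl a \<Rightarrow> v $ a | Inr b \<Rightarrow> w $ b)"
  shows "x \<bullet> (block_matrix P Q R S *v x) =
    v \<bullet> (P *v v) + v \<bullet> (Q *v w) + w \<bullet> (R *v v) + w \<bullet> (S *v w)"
proof -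
  have "sum h UNIV = (\<Sum>a\<in>UNIV. h (Inl a)) + (\<Sum>b\<in>UNIV. h (Inr b))" for h :: "'m + 'k \<Rightarrow> real"
    using sum.Plus[of "UNIV::'m set" "UNIV::'k set" h] by (simp add: o_def)
  then show ?thesis
    by (simp add: x_def block_matrix_def inner_vec_def matrix_vector_mult_def sum.distrib
        distrib_left)
qed

lemma block_vector_nonzero:
  fixes v :: "real^'m" and w :: "real^'k"
  assumes "v \<noteq> 0 \<or> w \<noteq> 0"
  shows "(\<chi> i. case i of Inl a \<Rightarrow> v $ a | Inr b \<Rightarrow> w $ b) \<noteq> 0"
proof
  assume "(\<chi> i. case i of Inl a \<Rightarrow> v $ a | Inr b \<Rightarrow> w $ b) = 0"
  then have "(case i of Inl a \<Rightarrow> v $ a | Inr b \<Rightarrow> w $ b) = 0" for i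
    by (simp add: vec_eq_iff)
  from this[of "Inl _"] this[of "Inr _"] have "v = 0" "w = 0"
    by (simp_all add: vec_eq_iff)
  with assms show False by simp
qed

section \<open>Passing from the vertices to the convex hull\<close>

lemma affine_fun_on_add:
  "affine_fun_on S f \<Longrightarrow> affine_fun_on S g \<Longrightarrow> affine_fun_on S (\<lambda>x. f x + g x)"
proof -
  assume "affine_fun_on S f" "affine_fun_on S g"
  then obtain c L d M where "linear L" "\<forall>x\<in>S. f x = c + L x" "linear M" "\<forall>x\<in>S. g x = d + M x"
    unfolding affine_fun_on_def by blast
  then show ?thesis
    unfolding affine_fun_on_def
    by (intro exI[of _ "c + d"] exI[of _ "\<lambda>x. L x + M x"]) (auto intro: linear_compose_add)
qed

lemma affine_fun_on_linear:
  assumes "affine_fun_on S f" "linear h"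
  shows "affine_fun_on S (\<lambda>x. h (f x))"
proof -
  from assms(1) obtain c L where "linear L" "\<forall>x\<in>S. f x = c + L x"
    unfolding affine_fun_on_def by blast
  then show ?thesis
    unfolding affine_fun_on_def
    by (intro exI[of _ "h c"] exI[of _ "h \<circ> L"])
      (auto simp: linear_add[OF assms(2)] linear_compose[OF _ assms(2)])
qed

lemma affine_fun_on_const: "affine_fun_on S (\<lambda>x. c)"
  unfolding affine_fun_on_def by (intro exI[of _ c] exI[of _ "\<lambda>x. 0"]) (auto intro: linear_zero)

text \<open>The globally defined affine function \<open>c + L x\<close> is negative on a convex set
  containing \<open>S\<close>, hence on the hull. It agrees with \<open>f\<close> there, although
  possibly not elsewhere.\<close>

lemma affine_fun_on_hull_neg:
  fixes f :: "'a::real_vector \<Rightarrow> real"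
  assumes "affine_fun_on (convex hull S) f" "\<And>x. x \<in> S \<Longrightarrow> f x < 0" "x \<in> convex hull S"
  shows "f x < 0"
proof -
  from assms(1) obtain c L where L: "linear L" "\<forall>x\<in>convex hull S. f x = c + L x"
    unfolding affine_fun_on_def by blast
  have "{x. c + L x < 0} = L -` {..< - c}" by auto
  then have "convex {x. c + L x < 0}"
    using convex_linear_vimage[OF L(1), of "{..< - c}"] by simp
  moreover have "S \<subseteq> {x. c + L x < 0}"
  proof
    fix y assume "y \<in> S"
    then show "y \<in> {x. c + L x < 0}"
      using assms(2)[of y] L(2)[rule_format, OF hull_inc] by simp
  qed
  ultimately have "x \<in> {x. c + L x < 0}"
    using hull_minimal assms(3) by blast
  then show ?thesis
    using assms(3) L(2) by simp
qed

section \<open>Quadratic forms and the inverse of the Lyapunov matrix\<close>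

lemma inner_transpose: "v \<bullet> (transpose M *v w) = (M *v v) \<bullet> w" for M :: "real^'n^'m"
  using dot_lmul_matrix[of w M v] by (simp add: inner_commute)

lemma inner_axis_mult_vec: "axis k 1 \<bullet> (M *v v) = M $ k \<bullet> v" for M :: "real^'n^'m"
  unfolding inner_axis' by (simp add: matrix_vector_mult_def inner_vec_def)

text \<open>With the test vectors fixed, the bilinear form is linear in the matrix. This turns a
  matrix inequality into scalar ones to which the hull argument applies.\<close>

lemma affine_fun_on_inner:
  fixes M :: "'a::real_vector \<Rightarrow> real^'n^'m"
  assumes "affine_fun_on S M"
  shows "affine_fun_on S (\<lambda>x. v \<bullet> (M x *v w))"
  using assms
  by (rule affine_fun_on_linear)
    (auto intro!: linearI simp: matrix_vector_mult_add_rdistrib inner_add_right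
      scaleR_matrix_vector_assoc[symmetric])

lemma pos_def_invertible: "pos_def X \<Longrightarrow> invertible X"
  unfolding invertible_left_inverse matrix_left_invertible_ker pos_def_def
  by (metis inner_zero_right less_irrefl)

lemma pos_def_matrix_inv:
  assumes X: "pos_def X"
  shows "pos_def (matrix_inv X)"
proof -
  let ?P = "matrix_inv X"
  note inv = matrix_inv_mult[OF pos_def_invertible[OF X]]
  have "transpose ?P ** X = mat 1"
    using inv(1) X by (metis matrix_transpose_mul pos_def_def transpose_mat)
  then have "transpose ?P = ?P"
    using inv by (metis matrix_mul_assoc matrix_mul_lid matrix_mul_rid)
  moreover have "v \<bullet> (?P *v v) > 0" if "v \<noteq> 0" for v
  proof -
    have v: "X *v (?P *v v) = v" using inv by (simp add: matrix_vector_mul_assoc)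
    then have "?P *v v \<noteq> 0" using that by auto
    then have "(?P *v v) \<bullet> (X *v (?P *v v)) > 0" using X by (simp add: pos_def_def)
    then show ?thesis unfolding v by (simp add: inner_commute)
  qed
  ultimately show ?thesis by (simp add: pos_def_def)
qed

text \<open>A congruence: substituting \<open>v = X p\<close> turns the form of
  \<open>A^T X^(-1) + X^(-1) A\<close> at \<open>v\<close> into \<open>2 p . A X p\<close>.\<close>

lemma lyapunov_neg_def:
  fixes A X :: "real^'n^'n"
  assumes X: "pos_def X" and neg: "\<And>p. p \<noteq> 0 \<Longrightarrow> p \<bullet> (A *v (X *v p)) < 0"
  shows "neg_def (transpose A ** matrix_inv X + matrix_inv X ** A)"
proof -
  let ?P = "matrix_inv X"
  have P: "pos_def ?P" by (rule pos_def_matrix_inv[OF X])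
  have "transpose (transpose A ** ?P + ?P ** A) = transpose (transpose A ** ?P) + transpose (?P ** A)"
    by (simp add: vec_eq_iff transpose_def)
  also have "\<dots> = transpose A ** ?P + ?P ** A"
    using P by (simp add: matrix_transpose_mul pos_def_def add.commute)
  finally have "transpose (transpose A ** ?P + ?P ** A) = transpose A ** ?P + ?P ** A" .
  moreover have "v \<bullet> ((transpose A ** ?P + ?P ** A) *v v) < 0" if "v \<noteq> 0" for v
  proof -
    let ?p = "?P *v v"
    have v: "X *v ?p = v"
      using matrix_inv_mult[OF pos_def_invertible[OF X]] by (simp add: matrix_vector_mul_assoc)
    then have "?p \<noteq> 0" using that by auto
    from neg[OF this] have "?p \<bullet> (A *v v) < 0" unfolding v .
    moreover have "v \<bullet> (transpose A *v ?p) = ?p \<bullet> (A *v v)"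
      unfolding inner_transpose by (rule inner_commute)
    moreover have "v \<bullet> (?P *v (A *v v)) = ?p \<bullet> (A *v v)"
      using pos_def_symmetric[OF P] by simp
    ultimately show ?thesis
      by (simp only: matrix_vector_mult_add_rdistrib inner_add_right flip: matrix_vector_mul_assoc)
  qed
  ultimately show ?thesis by (simp add: neg_def_def)
qed

section \<open>Feedback synthesis from the vertex inequalities\<close>

theorem theorem3:
  fixes E0 :: "(real^'p) set"
    and A :: "real^'p \<Rightarrow> real^'n^'n"
    and Bw :: "real^'p \<Rightarrow> real^'w^'n"
    and B :: "real^'p \<Rightarrow> real^'u^'n"
    and C :: "real^'p \<Rightarrow> real^'n^'z"
    and D :: "real^'p \<Rightarrow> real^'w^'z"
    and E :: "real^'p \<Rightarrow> real^'u^'z"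
    and X :: "real^'n^'n" and Y :: "real^'z^'z" and W K :: "real^'n^'u"
    and \<gamma> :: real
  assumes "finite E0"
    and "affine_fun_on (convex hull E0) A"
    and "affine_fun_on (convex hull E0) Bw"
    and "affine_fun_on (convex hull E0) B"
    and "affine_fun_on (convex hull E0) C"
    and "affine_fun_on (convex hull E0) D"
    and "affine_fun_on (convex hull E0) E"
    and "\<forall>\<xi>\<in>convex hull E0. D \<xi> = 0"
    and "\<gamma> > 0"
    and "pos_def X" and "pos_def Y"
    and "\<forall>\<xi>\<in>E0. neg_def (block_matrix
           (A \<xi> ** X + X ** transpose (A \<xi>) + B \<xi> ** W + transpose W ** transpose (B \<xi>))
           (Bw \<xi>)
           (transpose (Bw \<xi>))
           (- mat 1))"
    and "\<forall>\<xi>\<in>E0. pos_def (block_matrix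
           Y
           (C \<xi> ** X + E \<xi> ** W)
           (X ** transpose (C \<xi>) + transpose W ** transpose (E \<xi>))
           X)"
    and "trace Y < \<gamma>\<^sup>2"
    and "K = W ** matrix_inv X"
  shows "quadratically_stable (\<lambda>\<xi>. A \<xi> + B \<xi> ** K) (convex hull E0) \<and>
         (\<forall>\<xi>\<in>convex hull E0.
            h2_norm (A \<xi> + B \<xi> ** K) (Bw \<xi>) (C \<xi> + E \<xi> ** K) (D \<xi>) < ereal \<gamma>)"
proof -
  note X = \<open>pos_def X\<close>
  have XT: "transpose X = X" using X by (simp add: pos_def_def)
  have KX: "K *v (X *v p) = W *v p" for p
    unfolding \<open>K = W ** matrix_inv X\<close> matrix_vector_mul_assoc
    by (metis matrix_inv_mult(2)[OF pos_def_invertible[OF X]] matrix_mul_assoc matrix_mul_rid)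
  \<comment> \<open>Each transposed summand of the upper left block has the same quadratic form as
    its partner, which explains the factor 2 in \<open>lmi1\<close>.\<close>
  have sym: "p \<bullet> (X *v (transpose M *v p)) = p \<bullet> (M *v (X *v p))"
    "p \<bullet> (transpose W *v (transpose V *v p)) = p \<bullet> (V *v (W *v p))"
    for p and M :: "real^'n^'n" and V :: "real^'u^'n"
    by (simp_all only: inner_transpose pos_def_symmetric[OF X, symmetric]) (simp_all only: inner_commute)
  \<comment> \<open>The factor 2 is placed on the test vector so that every summand depending on the
    parameter has the form treated by \<open>affine_fun_on_inner\<close>.\<close>
  have lmi1: "(2 *\<^sub>R p) \<bullet> (A \<xi> *v (X *v p)) + (2 *\<^sub>R p) \<bullet> (B \<xi> *v (W *v p))
      + (2 *\<^sub>R p) \<bullet> (Bw \<xi> *v q) + - (q \<bullet> q) < 0" (is "?f \<xi> < 0")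
    if "p \<noteq> 0" "\<xi> \<in> convex hull E0" for p q \<xi>
  proof (rule affine_fun_on_hull_neg[of E0 ?f, OF _ _ that(2)])
    show "affine_fun_on (convex hull E0) ?f"
      by (intro affine_fun_on_add affine_fun_on_const affine_fun_on_inner assms)
    fix \<xi> assume "\<xi> \<in> E0"
    then have "p \<bullet> ((A \<xi> ** X + X ** transpose (A \<xi>) + B \<xi> ** W + transpose W ** transpose (B \<xi>)) *v p)
        + p \<bullet> (Bw \<xi> *v q) + q \<bullet> (transpose (Bw \<xi>) *v p) + q \<bullet> ((- mat 1) *v q) < 0"
      using assms(12) block_vector_nonzero[of p q] that(1)
      unfolding neg_def_def sum_type_inner_block[symmetric] by blast
    moreover have "q \<bullet> (transpose (Bw \<xi>) *v p) = p \<bullet> (Bw \<xi> *v q)"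
      unfolding inner_transpose by (rule inner_commute)
    moreover have "(- mat 1) *v q = - q"
      using scaleR_matrix_vector_assoc[of "-1" "mat 1" q] by simp
    ultimately show "?f \<xi> < 0"
      by (simp only: matrix_vector_mult_add_rdistrib inner_add_right sym flip: matrix_vector_mul_assoc)
        (simp add: algebra_simps)
  qed
  \<comment> \<open>The positivity condition is negated, because the hull lemma is stated for
    negative functions.\<close>
  have lmi2: "((- 2) *\<^sub>R e) \<bullet> (C \<xi> *v (X *v p)) + ((- 2) *\<^sub>R e) \<bullet> (E \<xi> *v (W *v p))
      + - (e \<bullet> (Y *v e) + p \<bullet> (X *v p)) < 0" (is "?f \<xi> < 0")
    if "e \<noteq> 0" "\<xi> \<in> convex hull E0" for e p \<xi>
  proof (rule affine_fun_on_hull_neg[of E0 ?f, OF _ _ that(2)])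
    show "affine_fun_on (convex hull E0) ?f"
      by (intro affine_fun_on_add affine_fun_on_const affine_fun_on_inner assms)
    fix \<xi> assume "\<xi> \<in> E0"
    then have "e \<bullet> (Y *v e) + e \<bullet> ((C \<xi> ** X + E \<xi> ** W) *v p)
        + p \<bullet> ((X ** transpose (C \<xi>) + transpose W ** transpose (E \<xi>)) *v e) + p \<bullet> (X *v p) > 0"
      using assms(13) block_vector_nonzero[of e p] that(1)
      unfolding pos_def_def sum_type_inner_block[symmetric] by blast
    moreover have "p \<bullet> (X *v (transpose (C \<xi>) *v e)) = e \<bullet> (C \<xi> *v (X *v p))"
      "p \<bullet> (transpose W *v (transpose (E \<xi>) *v e)) = e \<bullet> (E \<xi> *v (W *v p))"
      by (simp_all only: inner_transpose pos_def_symmetric[OF X, symmetric])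
        (simp_all only: inner_commute)
    ultimately show "?f \<xi> < 0"
      by (simp only: matrix_vector_mult_add_rdistrib inner_add_right flip: matrix_vector_mul_assoc)
        (simp add: algebra_simps)
  qed
  let ?Ac = "\<lambda>\<xi>. A \<xi> + B \<xi> ** K" and ?Cc = "\<lambda>\<xi>. C \<xi> + E \<xi> ** K"
  have Ac: "?Ac \<xi> *v (X *v p) = A \<xi> *v (X *v p) + B \<xi> *v (W *v p)" for \<xi> p
    by (simp only: matrix_vector_mult_add_rdistrib KX flip: matrix_vector_mul_assoc)
  have Cc: "?Cc \<xi> *v (X *v p) = C \<xi> *v (X *v p) + E \<xi> *v (W *v p)" for \<xi> p
    by (simp only: matrix_vector_mult_add_rdistrib KX flip: matrix_vector_mul_assoc)
  have lyap: "2 * ((X *v p) \<bullet> (transpose (?Ac \<xi>) *v p))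
      + (transpose (Bw \<xi>) *v p) \<bullet> (transpose (Bw \<xi>) *v p) < 0"
    if "p \<noteq> 0" "\<xi> \<in> convex hull E0" for p \<xi>
  proof -
    \<comment> \<open>This \<open>q\<close> maximises \<open>2 p . Bw q - q . q\<close>, with value
      \<open>q . q\<close>; the choice amounts to a Schur complement.\<close>
    define q where "q = transpose (Bw \<xi>) *v p"
    have "(X *v p) \<bullet> (transpose (?Ac \<xi>) *v p) = p \<bullet> (A \<xi> *v (X *v p)) + p \<bullet> (B \<xi> *v (W *v p))"
      unfolding inner_transpose Ac by (simp add: inner_add_left inner_add_right inner_commute)
    moreover have "p \<bullet> (Bw \<xi> *v q) = q \<bullet> q"
      using inner_transpose[of q "Bw \<xi>" p] unfolding q_def by (simp only: inner_commute)
    moreover note lmi1[OF that, of q]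
    moreover have "2 * a + 2 * b + 2 * d + - d < 0 \<Longrightarrow> 2 * (a + b) + d < 0" for a b d :: real
      by simp
    ultimately show ?thesis
      unfolding q_def[symmetric] by (simp only: inner_scaleR_left)
  qed
  have "neg_def (transpose (?Ac \<xi>) ** matrix_inv X + matrix_inv X ** ?Ac \<xi>)"
    if "\<xi> \<in> convex hull E0" for \<xi>
  proof (rule lyapunov_neg_def[OF X])
    fix p :: "real^'n" assume "p \<noteq> 0"
    then show "p \<bullet> (?Ac \<xi> *v (X *v p)) < 0"
      \<comment> \<open>With \<open>q = 0\<close> only the upper left block remains.\<close>
      using lmi1[OF _ that, of p 0] unfolding Ac by (simp add: inner_add_right)
  qed
  then have "quadratically_stable ?Ac (convex hull E0)"
    unfolding quadratically_stable_def using pos_def_matrix_inv[OF X] by blast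
  moreover have "h2_norm (?Ac \<xi>) (Bw \<xi>) (?Cc \<xi>) (D \<xi>) < ereal \<gamma>"
    if \<xi>: "\<xi> \<in> convex hull E0" for \<xi>
  proof -
    have "?Cc \<xi> $ k \<bullet> (X *v (?Cc \<xi> $ k)) < Y $ k $ k" for k
    proof -
      \<comment> \<open>For \<open>e\<close> the \<open>k\<close>-th unit vector,
        \<open>- ?c\<close> minimises \<open>e . Y e + 2 e . Cc X p + p . X p\<close> over
        \<open>p\<close>. The minimum is \<open>Y $ k $ k - ?c . X ?c\<close>, again a Schur
        complement.\<close>
      let ?c = "?Cc \<xi> $ k" and ?e = "axis k 1 :: real^'z"
      have neg: "X *v (- ?c) = - (X *v ?c)"
        using matrix_vector_mult_diff_distrib[of X 0 ?c] by simp
      have "?e \<bullet> (?Cc \<xi> *v (X *v (- ?c))) = - (?c \<bullet> (X *v ?c))"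
        unfolding inner_axis_mult_vec neg by (rule inner_minus_right)
      then have 1: "?e \<bullet> (C \<xi> *v (X *v (- ?c))) + ?e \<bullet> (E \<xi> *v (W *v (- ?c))) = - (?c \<bullet> (X *v ?c))"
        unfolding Cc by (simp only: inner_add_right)
      have 2: "?e \<bullet> (Y *v ?e) = Y $ k $ k"
        unfolding inner_axis_mult_vec by (simp add: inner_axis)
      have 3: "(- ?c) \<bullet> (X *v (- ?c)) = ?c \<bullet> (X *v ?c)"
        unfolding neg by (simp only: inner_minus_left inner_minus_right minus_minus)
      have 4: "- 2 * (?e \<bullet> (C \<xi> *v (X *v (- ?c)))) + - 2 * (?e \<bullet> (E \<xi> *v (W *v (- ?c))))
          + - (?e \<bullet> (Y *v ?e) + (- ?c) \<bullet> (X *v (- ?c))) < 0"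
        using lmi2[OF _ \<xi>, of ?e "- ?c"] unfolding inner_scaleR_left by (simp only: axis_eq_0_iff)
      have arith: "d < y" if "a + b = - d" "e = y" "f = d" "- 2 * a + - 2 * b + - (e + f) < 0"
        for a b d e f y :: real
        using that by linarith
      show ?thesis by (rule arith[OF 1 2 3 4])
    qed
    then have "(\<Sum>k\<in>UNIV. ?Cc \<xi> $ k \<bullet> (X *v (?Cc \<xi> $ k))) \<le> trace Y"
      unfolding trace_def by (intro sum_mono less_imp_le)
    also note \<open>trace Y < \<gamma>\<^sup>2\<close>
    finally have "sqrt (\<Sum>k\<in>UNIV. ?Cc \<xi> $ k \<bullet> (X *v (?Cc \<xi> $ k))) < sqrt (\<gamma>\<^sup>2)"
      by (rule real_sqrt_less_mono)
    also have "sqrt (\<gamma>\<^sup>2) = \<gamma>" using \<open>\<gamma> > 0\<close> by simp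
    finally have "ereal (sqrt (\<Sum>k\<in>UNIV. ?Cc \<xi> $ k \<bullet> (X *v (?Cc \<xi> $ k)))) < ereal \<gamma>"
      by (simp only: less_ereal.simps)
    moreover have "h2_norm (?Ac \<xi>) (Bw \<xi>) (?Cc \<xi>) 0
        \<le> ereal (sqrt (\<Sum>k\<in>UNIV. ?Cc \<xi> $ k \<bullet> (X *v (?Cc \<xi> $ k))))"
      using X lyap[OF _ \<xi>] by (rule h2_norm_le_gramian)
    moreover have "D \<xi> = 0" using assms(8) \<xi> by blast
    ultimately show ?thesis by (simp only: order_le_less_trans)
  qed
  ultimately show ?thesis by blast
qed

end
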